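(* Let $\langle X,\tau\rangle$ be a topological space, let $\mathcal{I}$ be the ideal of countable (i.e. at most countable) subsets of $X$, let $\tau_\omega$ be the topology of $\omega$-open subsets of $X$, and let $\tau^*=\tau^*(\mathcal{I})$ be the topology on $X$ obtained from $\tau$ and $\mathcal{I}$ by means of the local function. Then $\tau_\omega=\tau^*$.
   Context: Let $\langle X,\tau\rangle$ be a topological space. For $x\in X$, $\tau(x)$ denotes the family of open neighbourhoods of $x$ in $\tau$. "Countable" means of cardinality at most $\aleph_0$; the family of all countable subsets of $X$ is an ideal on $X$, denoted here by $\mathcal{I}$ (it contains $\emptyset$ and is closed under subsets and finite unions). The local function of $\langle X,\tau,\mathcal{I}\rangle$ assigns to each $A\subseteq X$ the set $$A^*=\{x\in X : A\cap U\notin\mathcal{I}\text{ for each }U\in\tau(x)\}.$$ The operator $\mathrm{Cl}^*(A)=A\cup A^*$ is a closure operator on the power set of $X$, and it generates the topology $$\tau^*(\mathcal{I})=\{U\subseteq X : \mathrm{Cl}^*(X\setminus U)=X\setminus U\},$$ written briefly $\tau^*$. A set is $\omega$-closed if it contains all of its $\omega$-accumulation points (points each of whose open neighbourhoods meets the set in an uncountable set), and $\omega$-open if its complement is $\omega$-closed. The family of all $\omega$-open sets is a topology on $X$, denoted $\tau_\omega$; equivalently, $A\in\tau_\omega$ if and only if for every $x\in A$ there exists $U\in\tau(x)$ with $|U\setminus A|\le\aleph_0$. *)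

theory Defs
  imports "HOL-Analysis.Analysis"
begin

definition ideal_on :: "'a set \<Rightarrow> 'a set set \<Rightarrow> bool" where
  "ideal_on S I \<longleftrightarrow>
     I \<subseteq> Pow S \<and> {} \<in> I \<and> (\<forall>A\<in>I. \<forall>B. B \<subseteq> A \<longrightarrow> B \<in> I) \<and> (\<forall>A\<in>I. \<forall>B\<in>I. A \<union> B \<in> I)"

definition countable_ideal :: "'a set \<Rightarrow> 'a set set" where
  "countable_ideal S = {A. A \<subseteq> S \<and> countable A}"

definition local_function :: "'a topology \<Rightarrow> 'a set set \<Rightarrow> 'a set \<Rightarrow> 'a set" where
  "local_function X I A = {x \<in> topspace X. \<forall>U. openin X U \<and> x \<in> U \<longrightarrow> A \<inter> U \<notin> I}"

definition star_closure :: "'a topology \<Rightarrow> 'a set set \<Rightarrow> 'a set \<Rightarrow> 'a set" where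
  "star_closure X I A = A \<union> local_function X I A"

(* The argument of topology is a topology whenever I is an ideal on the
   underlying set of X; see openin_star_topology. *)
definition star_topology :: "'a topology \<Rightarrow> 'a set set \<Rightarrow> 'a topology" where
  "star_topology X I =
     topology (\<lambda>U. U \<subseteq> topspace X \<and> star_closure X I (topspace X - U) = topspace X - U)"

definition omega_accumulation_points :: "'a topology \<Rightarrow> 'a set \<Rightarrow> 'a set" where
  "omega_accumulation_points X A =
     {x \<in> topspace X. \<forall>U. openin X U \<and> x \<in> U \<longrightarrow> uncountable (A \<inter> U)}"

definition omega_closed :: "'a topology \<Rightarrow> 'a set \<Rightarrow> bool" where
  "omega_closed X A \<longleftrightarrow> A \<subseteq> topspace X \<and> omega_accumulation_points X A \<subseteq> A"

definition omega_open :: "'a topology \<Rightarrow> 'a set \<Rightarrow> bool" where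
  "omega_open X A \<longleftrightarrow> A \<subseteq> topspace X \<and> omega_closed X (topspace X - A)"

(* The predicate omega_open X is always a topology; see openin_omega_topology. *)
definition omega_topology :: "'a topology \<Rightarrow> 'a topology" where
  "omega_topology X = topology (omega_open X)"

lemma ideal_on_countable_ideal: "ideal_on S (countable_ideal S)"
  unfolding ideal_on_def countable_ideal_def
  by (auto intro: countable_subset)

lemma istopology_star:
  assumes "ideal_on (topspace X) I"
  shows "istopology (\<lambda>U. U \<subseteq> topspace X \<and> star_closure X I (topspace X - U) = topspace X - U)"
proof -
  have sub: "B \<in> I" if "A \<in> I" "B \<subseteq> A" for A B
    using assms that unfolding ideal_on_def by blast
  have un: "A \<union> B \<in> I" if "A \<in> I" "B \<in> I" for A B
    using assms that unfolding ideal_on_def by blast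
  have eq: "(U \<subseteq> topspace X \<and> star_closure X I (topspace X - U) = topspace X - U) \<longleftrightarrow>
      U \<subseteq> topspace X \<and> (\<forall>x\<in>U. \<exists>V. openin X V \<and> x \<in> V \<and> (topspace X - U) \<inter> V \<in> I)" for U
    unfolding star_closure_def local_function_def by blast
  show ?thesis
    unfolding eq istopology_def
  proof (intro conjI allI impI ballI)
    fix S T x
    assume S: "S \<subseteq> topspace X \<and> (\<forall>x\<in>S. \<exists>V. openin X V \<and> x \<in> V \<and> (topspace X - S) \<inter> V \<in> I)"
      and T: "T \<subseteq> topspace X \<and> (\<forall>x\<in>T. \<exists>V. openin X V \<and> x \<in> V \<and> (topspace X - T) \<inter> V \<in> I)"
    show "S \<inter> T \<subseteq> topspace X" using S by blast
    assume x: "x \<in> S \<inter> T"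
    obtain V where V: "openin X V" "x \<in> V" "(topspace X - S) \<inter> V \<in> I" using S x by blast
    obtain W where W: "openin X W" "x \<in> W" "(topspace X - T) \<inter> W \<in> I" using T x by blast
    have "(topspace X - S \<inter> T) \<inter> (V \<inter> W) \<in> I"
      by (rule sub[OF un[OF V(3) W(3)]]) blast
    then show "\<exists>V. openin X V \<and> x \<in> V \<and> (topspace X - S \<inter> T) \<inter> V \<in> I"
      using V W by (intro exI[of _ "V \<inter> W"]) auto
  next
    fix K x
    assume K: "\<forall>S\<in>K. S \<subseteq> topspace X \<and>
        (\<forall>x\<in>S. \<exists>V. openin X V \<and> x \<in> V \<and> (topspace X - S) \<inter> V \<in> I)"
    show "\<Union>K \<subseteq> topspace X" using K by blast
    assume "x \<in> \<Union>K"
    then obtain S where S: "S \<in> K" "x \<in> S" by blast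
    then obtain V where V: "openin X V" "x \<in> V" "(topspace X - S) \<inter> V \<in> I" using K by blast
    have "(topspace X - \<Union>K) \<inter> V \<in> I"
      by (rule sub[OF V(3)]) (use S in blast)
    then show "\<exists>V. openin X V \<and> x \<in> V \<and> (topspace X - \<Union>K) \<inter> V \<in> I"
      using V by blast
  qed
qed

lemma openin_star_topology:
  assumes "ideal_on (topspace X) I"
  shows "openin (star_topology X I) U \<longleftrightarrow>
    U \<subseteq> topspace X \<and> star_closure X I (topspace X - U) = topspace X - U"
  unfolding star_topology_def using istopology_star[OF assms] by simp

lemma istopology_omega_open: "istopology (omega_open X)"
proof -
  have eq: "omega_open X U \<longleftrightarrow>
      U \<subseteq> topspace X \<and> (\<forall>x\<in>U. \<exists>V. openin X V \<and> x \<in> V \<and> countable (V - U))" for U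
  proof -
    have "(topspace X - U) \<inter> V = V - U" if "openin X V" for V
      using openin_subset[OF that] by blast
    then show ?thesis
      unfolding omega_open_def omega_closed_def omega_accumulation_points_def
      by (auto simp: subset_iff)
  qed
  show ?thesis
    unfolding istopology_def
  proof (intro conjI allI impI)
    fix S T
    assume S: "omega_open X S" and T: "omega_open X T"
    show "omega_open X (S \<inter> T)"
      unfolding eq
    proof (intro conjI ballI)
      show "S \<inter> T \<subseteq> topspace X" using S unfolding eq by blast
      fix x assume x: "x \<in> S \<inter> T"
      obtain V where V: "openin X V" "x \<in> V" "countable (V - S)" using S x unfolding eq by blast
      obtain W where W: "openin X W" "x \<in> W" "countable (W - T)" using T x unfolding eq by blast
      have "countable (V \<inter> W - S \<inter> T)"
        by (rule countable_subset[of _ "(V - S) \<union> (W - T)"]) (use V W in auto)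
      then show "\<exists>V. openin X V \<and> x \<in> V \<and> countable (V - S \<inter> T)"
        using V W by (intro exI[of _ "V \<inter> W"]) auto
    qed
  next
    fix K
    assume K: "\<forall>S\<in>K. omega_open X S"
    show "omega_open X (\<Union>K)"
      unfolding eq
    proof (intro conjI ballI)
      show "\<Union>K \<subseteq> topspace X" using K unfolding eq by blast
      fix x assume "x \<in> \<Union>K"
      then obtain S where S: "S \<in> K" "x \<in> S" by blast
      then obtain V where V: "openin X V" "x \<in> V" "countable (V - S)"
        using K unfolding eq by blast
      have "countable (V - \<Union>K)"
        by (rule countable_subset[OF _ V(3)]) (use S in blast)
      then show "\<exists>V. openin X V \<and> x \<in> V \<and> countable (V - \<Union>K)"
        using V by blast
    qed
  qed
qed

lemma openin_omega_topology: "openin (omega_topology X) U \<longleftrightarrow> omega_open X U"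
  unfolding omega_topology_def by (simp add: istopology_omega_open topology_inverse')

end

theory Submission
  imports Defs
begin

text \<open>For a set \<open>A\<close> of points of the space, a trace \<open>A \<inter> U\<close> fails to lie in the ideal of
  countable sets exactly when it is uncountable, so the local function of this ideal assigns to
  \<open>A\<close> its set of \<open>\<omega>\<close>-accumulation points. Being a fixed point of the star closure then
  means containing all these points, that is, being \<open>\<omega>\<close>-closed; the two topologies have the
  same closed sets and hence coincide.\<close>

lemma local_function_countable_ideal:
  assumes "A \<subseteq> topspace X"
  shows "local_function X (countable_ideal (topspace X)) A = omega_accumulation_points X A"
proof -
  have "A \<inter> U \<notin> countable_ideal (topspace X) \<longleftrightarrow> uncountable (A \<inter> U)" for U
    using assms unfolding countable_ideal_def by blast
  then show ?thesis
    unfolding local_function_def omega_accumulation_points_def by simp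
qed

lemma star_closure_countable_ideal_fixed_iff:
  assumes "A \<subseteq> topspace X"
  shows "star_closure X (countable_ideal (topspace X)) A = A \<longleftrightarrow> omega_closed X A"
  using assms
  unfolding star_closure_def omega_closed_def local_function_countable_ideal[OF assms] by blast

theorem corollary1:
  fixes X :: "'a topology"
  shows "omega_topology X = star_topology X (countable_ideal (topspace X))"
  unfolding topology_eq openin_omega_topology
    openin_star_topology[OF ideal_on_countable_ideal] omega_open_def
  by (simp add: star_closure_countable_ideal_fixed_iff)

end
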